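(* Let $n$ be a non-negative integer and let $q,z$ be complex numbers with $q\neq 0$ such that no denominator below vanishes (i.e. $(q;q)_n\neq 0$). Then $${}_1\phi_0\left[\begin{matrix} q^{-n}\\ -\end{matrix};q,z\right]=(zq^{-n};q)_n .$$
   Context: For complex $a,q$ and a non-negative integer $n$, $(a;q)_n:=\prod_{k=0}^{n-1}(1-aq^k)$, with $(a;q)_0=1$, and $(a_1,\ldots,a_k;q)_n:=\prod_{i=1}^k (a_i;q)_n$. The unilateral basic hypergeometric series is $${}_{r+1}\phi_r\left[\begin{matrix} a_0,\ldots,a_r\\ b_1,\ldots,b_r\end{matrix};q,z\right]:=\sum_{j=0}^{\infty}\frac{(a_0,\ldots,a_r;q)_j}{(q,b_1,\ldots,b_r;q)_j}z^j .$$ For $r=0$ there are no lower parameters (denoted by $-$). When one numerator parameter is $q^{-n}$ the series terminates and is read as the finite sum over $0\le j\le n$ (so no convergence condition on $z$ is needed). *)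

theory Defs
  imports Complex_Main
begin

definition qpoch :: "complex \<Rightarrow> complex \<Rightarrow> nat \<Rightarrow> complex" where
  "qpoch a q n = (\<Prod>k<n. 1 - a * q ^ k)"

definition qpochs :: "complex list \<Rightarrow> complex \<Rightarrow> nat \<Rightarrow> complex" where
  "qpochs as q n = (\<Prod>a\<leftarrow>as. qpoch a q n)"

(* The series with upper parameters as = [a_0,...,a_r] and lower parameters bs = [b_1,...,b_r];
   it is the (r+1)-phi-r series only when length as = length bs + 1. *)
definition qhyp :: "complex list \<Rightarrow> complex list \<Rightarrow> complex \<Rightarrow> complex \<Rightarrow> complex" where
  "qhyp as bs q z = (\<Sum>j. qpochs as q j / qpochs (q # bs) q j * z ^ j)"

(* With an upper parameter q^(-n), every numerator with j > n vanishes, so (also when a later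
   denominator is zero, because 0 / 0 = 0) the infinite sum is the finite sum over 0 <= j <= n,
   for every z. *)
lemma qhyp_terminating:
  assumes "q \<noteq> 0" and "q powi (- int n) \<in> set as"
  shows "qhyp as bs q z = (\<Sum>j\<le>n. qpochs as q j / qpochs (q # bs) q j * z ^ j)"
proof -
  have "qpochs as q j = 0" if "n < j" for j
  proof -
    have "1 - q powi (- int n) * q ^ n = 0"
      using assms(1) by (simp add: power_int_minus)
    then have "qpoch (q powi (- int n)) q j = 0"
      using that unfolding qpoch_def by (intro prod_zero) auto
    then show ?thesis
      using assms(2) unfolding qpochs_def by (force simp: prod_list_zero_iff)
  qed
  then show ?thesis
    unfolding qhyp_def by (intro suminf_finite) auto
qed

end

theory Submission
  imports Defs
begin

text \<open>The identity is the terminating \<open>q\<close>-binomial theorem, and it holds because both sides obey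
  the same first-order recurrence in \<open>n\<close> with \<open>z\<close> held fixed. Raising \<open>n\<close> by one multiplies the
  product \<open>(z q\<^sup>-\<^sup>n; q)\<^sub>n\<close> by the new leading factor \<open>1 - z q\<^sup>-\<^sup>n\<^sup>-\<^sup>1\<close>, the other factors being
  unchanged. On the side of the series, multiplication by this factor sends the coefficient
  \<open>c\<^sub>j = (q\<^sup>-\<^sup>n; q)\<^sub>j / (q; q)\<^sub>j\<close> to \<open>c\<^sub>j - q\<^sup>-\<^sup>n\<^sup>-\<^sup>1 c\<^sub>j\<^sub>-\<^sub>1\<close>, and a Pascal-type rule
  (\<open>qbinomial_coeff_Pascal\<close>) identifies this with the coefficient for \<open>n + 1\<close>.\<close>

lemma qpoch_0 [simp]: "qpoch a q 0 = 1"
  by (simp add: qpoch_def)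

lemma qpoch_Suc: "qpoch a q (Suc j) = qpoch a q j * (1 - a * q ^ j)"
  by (simp add: qpoch_def)

lemma qpoch_Suc_shift: "qpoch a q (Suc j) = (1 - a) * qpoch (a * q) q j"
  unfolding qpoch_def by (subst prod.lessThan_Suc_shift) (simp add: mult.assoc)

lemma qpoch_nonzero_mono:
  assumes "qpoch a q n \<noteq> 0" and "j \<le> n"
  shows "qpoch a q j \<noteq> 0"
  using assms by (auto simp: qpoch_def)

text \<open>Both \<open>q\<close>-shifted factorials of length \<open>j + 1\<close> share the factor \<open>(b q; q)\<^sub>j\<close>; once it is
  removed, only \<open>1 - b = (1 - b q\<^sup>j\<^sup>+\<^sup>1) - b (1 - q\<^sup>j\<^sup>+\<^sup>1)\<close> remains.\<close>

lemma qbinomial_coeff_Pascal: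
  assumes "qpoch q q (Suc j) \<noteq> 0"
  shows "qpoch b q (Suc j) / qpoch q q (Suc j)
    = qpoch (b * q) q (Suc j) / qpoch q q (Suc j) - b * (qpoch (b * q) q j / qpoch q q j)"
proof -
  have nz: "qpoch q q j \<noteq> 0" "1 - q * q ^ j \<noteq> 0"
    using assms by (auto simp: qpoch_Suc)
  have "qpoch b q (Suc j) = qpoch (b * q) q (Suc j) - b * (1 - q * q ^ j) * qpoch (b * q) q j"
    unfolding qpoch_Suc_shift[of b] qpoch_Suc[of "b * q"] by (simp add: algebra_simps)
  moreover have "b * (qpoch (b * q) q j / qpoch q q j)
    = b * (1 - q * q ^ j) * qpoch (b * q) q j / qpoch q q (Suc j)"
    using nz unfolding qpoch_Suc[of q] by simp
  ultimately show ?thesis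
    by (simp only: diff_divide_distrib)
qed

lemma terminating_qbinomial_sum:
  assumes "q \<noteq> 0" and "qpoch q q n \<noteq> 0"
  shows "(\<Sum>j\<le>n. qpoch (inverse (q ^ n)) q j / qpoch q q j * z ^ j)
    = qpoch (z * inverse (q ^ n)) q n"
  using assms(2)
proof (induction n)
  case 0
  show ?case by simp
next
  case (Suc n)
  define b where "b = inverse (q ^ Suc n)"
  define c where "c j = qpoch (b * q) q j / qpoch q q j" for j
  have bq: "b * q = inverse (q ^ n)"
    using assms(1) by (simp add: b_def field_simps)
  have IH: "(\<Sum>j\<le>n. c j * z ^ j) = qpoch (z * (b * q)) q n"
    using Suc.IH qpoch_nonzero_mono[OF Suc.prems, of n] unfolding c_def bq by simp
  have Pascal: "qpoch b q (Suc j) / qpoch q q (Suc j) = c (Suc j) - b * c j" if "j \<le> n" for j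
    unfolding c_def using qpoch_nonzero_mono[OF Suc.prems, of "Suc j"] that
    by (intro qbinomial_coeff_Pascal) simp
  \<comment> \<open>The series for \<open>n\<close> has no term of degree \<open>n + 1\<close>, so it may be summed one index further.\<close>
  have top: "c (Suc n) = 0"
    using assms(1) by (simp add: c_def bq qpoch_Suc)
  have "(\<Sum>j\<le>Suc n. qpoch b q j / qpoch q q j * z ^ j)
      = 1 + (\<Sum>j\<le>n. (c (Suc j) - b * c j) * z ^ Suc j)"
    by (subst sum.atMost_Suc_shift) (simp add: Pascal)
  also have "\<dots> = (1 + (\<Sum>j\<le>n. c (Suc j) * z ^ Suc j)) - z * b * (\<Sum>j\<le>n. c j * z ^ j)"
    by (simp add: sum_subtractf sum_distrib_left algebra_simps)
  also have "1 + (\<Sum>j\<le>n. c (Suc j) * z ^ Suc j) = (\<Sum>j\<le>Suc n. c j * z ^ j)"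
    by (subst sum.atMost_Suc_shift) (simp add: c_def)
  also have "\<dots> = (\<Sum>j\<le>n. c j * z ^ j)"
    by (simp add: top)
  also have "(\<Sum>j\<le>n. c j * z ^ j) - z * b * (\<Sum>j\<le>n. c j * z ^ j)
      = (1 - z * b) * qpoch (z * b * q) q n"
    by (simp add: IH algebra_simps)
  also have "\<dots> = qpoch (z * b) q (Suc n)"
    by (simp add: qpoch_Suc_shift)
  finally show ?case
    by (simp only: b_def)
qed

theorem theorem1p1:
  fixes n :: nat and q z :: complex
  assumes "q \<noteq> 0"
    and "qpoch q q n \<noteq> 0"
  shows "qhyp [q powi (- int n)] [] q z = qpoch (z * q powi (- int n)) q n"
proof -
  have "qhyp [q powi (- int n)] [] q z
      = (\<Sum>j\<le>n. qpoch (q powi (- int n)) q j / qpoch q q j * z ^ j)"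
    by (subst qhyp_terminating[OF assms(1)]) (simp_all add: qpochs_def)
  then show ?thesis
    using terminating_qbinomial_sum[OF assms] by (simp add: power_int_minus)
qed

end
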